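(* Let $D_1$ and $D_2$ be two vertex disjoint Hamiltonian digraphs of order $n$ and $m$, respectively, with $n\geq m$; let $d=\gcd(n,m)$; and let $D$ be a strongly connected digraph in $D_1\oplus D_2$. Then at least one of the following assertions holds: (i) $D$ is vertex-pancyclic; (ii) $D$ is pancyclic; or (iii) $D$ is Hamiltonian and it contains a cycle of length $l$ for each integer $l\in \{3,4,\ldots,n+1\}\cup \{n+id \colon i \text{ an integer},\ 0\leq i < m/d\}$.
   Context: Digraphs are finite, without loops or parallel arcs; a pair of opposite arcs $(u,v),(v,u)$ is allowed and forms a cycle of length 2. "Cycle" means directed cycle (no repeated vertices), and its length is its number of arcs. A digraph is Hamiltonian if it has a cycle containing all its vertices. A digraph is strong (strongly connected) if for each pair of different vertices $u,v$ there exist a directed path from $u$ to $v$ and one from $v$ to $u$. A digraph $D$ of order $N\geq 3$ is pancyclic if it contains a cycle of length $l$ for each $l\in\{3,\ldots,N\}$. It is vertex-pancyclic if for each vertex $v$ and each $l\in\{3,\ldots,N\}$ it contains a cycle of length $l$ passing through $v$. Generalized sum: for vertex disjoint digraphs $D_1,D_2$, the set $D_1\oplus D_2$ consists of all digraphs $D$ such that (1) $V(D)=V(D_1)\cup V(D_2)$; (2) for $i=1,2$ the subdigraph of $D$ induced by $V(D_i)$ is $D_i$; (3) for each $u\in V(D_1)$ and $v\in V(D_2)$, exactly one of $(u,v)$, $(v,u)$ is an arc of $D$ (directions being arbitrary). *)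

theory Defs
  imports "Graph_Theory.Graph_Theory"
begin

text \<open>
  Digraphs without loops and parallel arcs are the finite digraphs of locale
  \<^locale>\<open>pair_digraph\<close>, whose arcs are pairs of vertices. A cycle is a list of arcs,
  so its length is its number of arcs. The library notion
  \<^const>\<open>pre_digraph.cycle\<close> also admits a single loop, which does not exist in a
  \<^locale>\<open>pair_digraph\<close>; there every cycle has length at least 2, and in particular
  no one-vertex digraph is Hamiltonian.
\<close>

definition cycle_verts :: "('a, 'b) pre_digraph \<Rightarrow> 'b awalk \<Rightarrow> 'a set" where
  "cycle_verts G p = tail G ` set p"

definition hamiltonian :: "('a, 'b) pre_digraph \<Rightarrow> bool" where
  "hamiltonian G \<longleftrightarrow> (\<exists>p. pre_digraph.cycle G p \<and> cycle_verts G p = verts G)"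

definition has_cycle_of_length :: "('a, 'b) pre_digraph \<Rightarrow> nat \<Rightarrow> bool" where
  "has_cycle_of_length G l \<longleftrightarrow> (\<exists>p. pre_digraph.cycle G p \<and> length p = l)"

definition pancyclic :: "('a, 'b) pre_digraph \<Rightarrow> bool" where
  "pancyclic G \<longleftrightarrow>
     card (verts G) \<ge> 3 \<and> (\<forall>l \<in> {3..card (verts G)}. has_cycle_of_length G l)"

definition vertex_pancyclic :: "('a, 'b) pre_digraph \<Rightarrow> bool" where
  "vertex_pancyclic G \<longleftrightarrow>
     card (verts G) \<ge> 3 \<and>
     (\<forall>v \<in> verts G. \<forall>l \<in> {3..card (verts G)}.
        \<exists>p. pre_digraph.cycle G p \<and> length p = l \<and> v \<in> cycle_verts G p)"

text \<open>
  The generalized sum; it is only meaningful for vertex disjoint summands.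
  The induced subdigraph \<open>D \<restriction> V\<close> lives in the type \<^typ>\<open>('a, 'a \<times> 'a) pre_digraph\<close>,
  into which \<^const>\<open>with_proj\<close> embeds the pair digraphs injectively.
\<close>

definition generalized_sum ::
  "'a pair_pre_digraph \<Rightarrow> 'a pair_pre_digraph \<Rightarrow> 'a pair_pre_digraph set"  (infixl "\<oplus>\<^sub>g" 65)
where
  "D1 \<oplus>\<^sub>g D2 = {D. pair_digraph D \<and>
     pverts D = pverts D1 \<union> pverts D2 \<and>
     with_proj D \<restriction> pverts D1 = with_proj D1 \<and>
     with_proj D \<restriction> pverts D2 = with_proj D2 \<and>
     (\<forall>u \<in> pverts D1. \<forall>v \<in> pverts D2. ((u, v) \<in> parcs D) \<noteq> ((v, u) \<in> parcs D))}"

end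

(*
  Assertion (iii) always holds. Write the summands' spanning cycles as u and v with indices in Z/n and
  Z/m, and let F i j say that (u i, v j) is an arc. A cycle made of a consecutive vertices of u and b
  consecutive vertices of v exists unless F is invariant under the shift (1 - a, b - 1). Without a
  spanning cycle of this kind, F i j depends only on i + j; without such cycles of a length l strictly
  between 2 and n + m, it depends (l - 2)-periodically on i - j only. As D is strong, F is not constant,
  so the resulting periodic function changes value somewhere in both directions, and at such places one
  can form a cycle of the required length that visits both u and v twice.
*)
theory Submission
  imports Defs "HOL-Number_Theory.Cong"
begin

section \<open>Cycles as lists of vertices\<close>

lemma pcas_vwalk_arcs: "xs \<noteq> [] \<Longrightarrow> pcas (hd xs) (vwalk_arcs xs) (last xs)"
  by (induction xs rule: vwalk_arcs.induct) auto

lemma pawalk_verts_vwalk_arcs: "xs \<noteq> [] \<Longrightarrow> pawalk_verts (hd xs) (vwalk_arcs xs) = xs"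
  by (induction xs rule: vwalk_arcs.induct) auto

lemma snd_last_of_pcas: "pcas x p y \<Longrightarrow> p \<noteq> [] \<Longrightarrow> snd (last p) = y"
  by (induction x p y rule: pcas.induct) (auto split: if_splits)

lemma length_vwalk_arcs: "length (vwalk_arcs xs) = length xs - 1"
  by (induction xs rule: vwalk_arcs.induct) auto

lemma vwalk_arcs_map_upt:
  "vwalk_arcs (map f [0..<Suc k]) = map (\<lambda>j. (f j, f (Suc j))) [0..<k]"
proof (induction k)
  case (Suc k)
  have "vwalk_arcs (map f [0..<Suc k] @ [f (Suc k)])
      = vwalk_arcs (map f [0..<Suc k]) @ [(f k, f (Suc k))]"
    by (subst vwalk_arcs_append) auto
  with Suc show ?case by simp
qed simp

context pair_digraph
begin

text \<open>Bridge from vertex lists, in which the constructions below are written, to arc lists: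
  repeating the first vertex at the end closes the walk, and dropping the head of the result leaves
  a rotation of \<open>ws\<close>.\<close>

lemma has_cycle_of_vertex_list:
  assumes "distinct ws" "ws \<noteq> []" "set (vwalk_arcs ws) \<subseteq> parcs G" "(last ws, hd ws) \<in> parcs G"
  shows "has_cycle_of_length (with_proj G) (length ws)"
proof -
  let ?xs = "ws @ [hd ws]"
  let ?p = "vwalk_arcs ?xs"
  have p: "?p = vwalk_arcs ws @ [(last ws, hd ws)]"
    using assms(2) by (subst vwalk_arcs_append) auto
  have hd: "hd ?xs = hd ws" and last: "last ?xs = hd ws"
    using assms(2) by auto
  have "awalk (hd ws) ?p (hd ws)"
    unfolding awalk_def using pcas_vwalk_arcs[of ?xs] hd last assms(3,4) p
    by (auto simp: in_arcsD2)
  moreover have "pawalk_verts (hd ws) ?p = ?xs"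
    using pawalk_verts_vwalk_arcs[of ?xs] hd by simp
  moreover have "distinct (tl ?xs)"
    using assms(1,2) by (cases ws) auto
  ultimately have "cycle ?p"
    unfolding cycle_def using p by auto
  moreover have "length ?p = length ws"
    by (simp add: length_vwalk_arcs)
  ultimately show ?thesis
    unfolding has_cycle_of_length_def by blast
qed

lemma cycleD:
  assumes "cycle p"
  shows "distinct (map fst p)" "2 \<le> length p" "set p \<subseteq> parcs G"
    "\<And>k. k < length p \<Longrightarrow> p ! k = (fst (p ! k), fst (p ! (Suc k mod length p)))"
proof -
  obtain x where x: "awalk x p x" "distinct (tl (pawalk_verts x p))" "2 \<le> length p"
    using assms cycle_digraph_conv by auto
  then have ne: "p \<noteq> []" and cas: "pcas x p x" and sub: "set p \<subseteq> parcs G"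
    by (auto simp: awalk_def)
  show "2 \<le> length p" "set p \<subseteq> parcs G" by fact+
  have hd: "fst (hd p) = x" using cas ne by (cases p) auto
  have last: "snd (last p) = x"
    using cas ne snd_last_of_pcas by metis
  have v1: "pawalk_verts x p = map fst p @ [x]"
    using awalk_verts_conv[of x p] ne last by simp
  have v2: "pawalk_verts x p = x # map snd p"
    using awalk_verts_conv'[of x p x] cas ne hd by simp
  \<comment> \<open>Both lists are the vertex sequence of the closed walk. Cancelling
    \<open>x\<close> carries distinctness over from the heads of the arcs to their tails.\<close>
  have "mset (map fst p @ [x]) = mset (x # map snd p)"
    using v1 v2 by metis
  then have "mset (map fst p) = mset (map snd p)" by simp
  moreover have "distinct (map snd p)" using x(2) v2 by simp
  ultimately show "distinct (map fst p)" by (metis mset_eq_imp_distinct_iff)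
  fix k assume k: "k < length p"
  have "snd (p ! k) = (x # map snd p) ! Suc k" using k by simp
  also have "\<dots> = (map fst p @ [x]) ! Suc k" using v1 v2 by metis
  also have "\<dots> = fst (p ! (Suc k mod length p))"
  proof (cases "Suc k = length p")
    case True
    then show ?thesis using hd ne by (simp add: nth_append hd_conv_nth)
  next
    case False
    then have "Suc k < length p" using k by simp
    then show ?thesis by (simp add: nth_append)
  qed
  finally show "p ! k = (fst (p ! k), fst (p ! (Suc k mod length p)))"
    by (metis prod.collapse)
qed

lemma spanning_cycle_imp_hamiltonian:
  assumes "has_cycle_of_length (with_proj G) (card (pverts G))"
  shows "hamiltonian (with_proj G)"
proof -
  obtain p where p: "cycle p" "length p = card (pverts G)"
    using assms unfolding has_cycle_of_length_def by blast
  have "card (fst ` set p) = card (pverts G)"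
    using cycleD(1)[OF p(1)] p(2) distinct_card[of "map fst p"] by simp
  moreover have "fst ` set p \<subseteq> pverts G"
    using cycleD(3)[OF p(1)] arc_fst_in_verts by blast
  ultimately have "fst ` set p = pverts G"
    using pair_finite_verts by (metis card_subset_eq)
  then show ?thesis
    unfolding hamiltonian_def cycle_verts_def using p(1) by auto
qed

text \<open>Indexing the spanning cycle by all integers, periodically, allows shifts of indices
  without reduction modulo \<open>n\<close> at each step.\<close>

lemma hamiltonian_periodic_enumeration:
  assumes "hamiltonian (with_proj G)" and "card (pverts G) = n"
  obtains u :: "int \<Rightarrow> 'a"
  where "2 \<le> n" "\<forall>i j. u i = u j \<longleftrightarrow> [i = j] (mod int n)"
    "\<forall>i. (u i, u (i + 1)) \<in> parcs G" "range u = pverts G"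
proof -
  obtain p where p: "cycle p" and pv: "fst ` set p = pverts G"
    using assms(1) unfolding hamiltonian_def cycle_verts_def by auto
  note c = cycleD[OF p]
  have len: "length p = n"
    using distinct_card[OF c(1)] pv assms(2) by simp
  then have n: "2 \<le> n" using c(2) by simp
  define u where "u i = fst (p ! nat (i mod int n))" for i
  have lt: "nat (i mod int n) < n" for i
    using n by (simp add: nat_less_iff)
  have inj: "u i = u j \<longleftrightarrow> [i = j] (mod int n)" for i j
  proof -
    have "u i = u j \<longleftrightarrow> nat (i mod int n) = nat (j mod int n)"
      using nth_eq_iff_index_eq[OF c(1)] lt[of i] lt[of j] len by (simp add: u_def)
    also have "\<dots> \<longleftrightarrow> i mod int n = j mod int n"
      using n by (subst eq_nat_nat_iff) auto
    finally show ?thesis by (simp add: cong_def)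
  qed
  have arc: "(u i, u (i + 1)) \<in> parcs G" for i
  proof -
    let ?k = "nat (i mod int n)"
    have "int (Suc ?k mod n) = (i + 1) mod int n"
      using n by (simp add: zmod_int mod_simps add.commute)
    then have "nat ((i + 1) mod int n) = Suc ?k mod n" by linarith
    then have "(u i, u (i + 1)) = p ! ?k"
      using c(4)[of ?k] lt[of i] len by (simp add: u_def)
    also have "\<dots> \<in> set p" using lt[of i] len by simp
    finally show ?thesis using c(3) by blast
  qed
  have "range u = fst ` set p"
  proof
    show "range u \<subseteq> fst ` set p" using lt len by (auto simp: u_def)
    show "fst ` set p \<subseteq> range u"
    proof
      fix x assume "x \<in> fst ` set p"
      then obtain k where "k < n" "x = fst (p ! k)"
        using len by (auto simp: in_set_conv_nth)
      then have "x = u (int k)" by (simp add: u_def)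
      then show "x \<in> range u" by blast
    qed
  qed
  then show thesis using that[of u] n inj arc pv by simp
qed

end

section \<open>Periodic predicates on the integers\<close>

text \<open>Without an ascent, falsity would spread from \<open>a\<close> to everything on its
  right, yet \<open>b\<close> plus enough periods lies there.\<close>

lemma periodic_imp_ascent:
  fixes h :: "int \<Rightarrow> bool" and k :: nat
  assumes per: "\<And>x. h (x + int k) = h x" and "k > 0" and "\<not> h a" and "h b"
  obtains x where "\<not> h x" "h (x + 1)"
proof (rule ccontr)
  assume "\<not> thesis"
  then have step: "\<not> h x \<Longrightarrow> \<not> h (x + 1)" for x using that by blast
  have up: "\<not> h (a + int j)" for j
    by (induction j) (use \<open>\<not> h a\<close> step[of "a + int j" for j] in \<open>auto simp: algebra_simps\<close>)
  have mult: "h (b + int j * int k) = h b" for j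
    by (induction j) (use per[of "b + int j * int k" for j] in \<open>auto simp: algebra_simps\<close>)
  \<comment> \<open>As \<open>k\<close> is at least 1, this many periods carry \<open>b\<close> to
    \<open>a\<close> or beyond.\<close>
  let ?j = "nat \<bar>a - b\<bar>"
  have "a \<le> b + int ?j * int k"
    using \<open>k > 0\<close> mult_left_mono[of 1 "int k" "int ?j"] by linarith
  then obtain j where "b + int ?j * int k = a + int j"
    by (metis zle_iff_zadd)
  then show False using up mult \<open>h b\<close> by metis
qed

lemma periodic_imp_descent:
  fixes h :: "int \<Rightarrow> bool" and k :: nat
  assumes "\<And>x. h (x + int k) = h x" and "k > 0" and "\<not> h a" and "h b"
  obtains x where "h x" "\<not> h (x + 1)"
  using periodic_imp_ascent[of "\<lambda>x. \<not> h x" k b a] assms by auto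

lemma periodic_int_multiple:
  fixes h :: "int \<Rightarrow> bool"
  assumes per: "\<And>x. h (x + k) = h x"
  shows "h (x + c * k) = h x"
proof -
  have nat: "h (y + int j * k) = h y" for y j
    by (induction j) (use per[of "y + int j * k" for j] in \<open>auto simp: algebra_simps\<close>)
  show ?thesis
  proof (cases "c \<ge> 0")
    case True
    then show ?thesis using nat[of x "nat c"] by simp
  next
    case False
    then show ?thesis using nat[of "x + c * k" "nat (- c)"] by (simp add: algebra_simps)
  qed
qed

lemma periodic_gcd_multiple:
  fixes h :: "int \<Rightarrow> bool"
  assumes "\<And>x. h (x + k) = h x" "\<And>x. h (x + l) = h x" "gcd k l dvd c"
  shows "h (x + c) = h x"
proof -
  obtain s t where "s * k + t * l = gcd k l" using bezout_int by blast
  moreover obtain q where "c = gcd k l * q" using assms(3) by blast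
  ultimately have "c = (s * k + t * l) * q" by simp
  then have "x + c = (x + (q * s) * k) + (q * t) * l"
    by (simp add: algebra_simps)
  then show ?thesis
    using periodic_int_multiple[of h, OF assms(1)] periodic_int_multiple[of h, OF assms(2)] by metis
qed

section \<open>Two cycles joined by a bipartite tournament\<close>

text \<open>Since \<open>f\<close> is defined on all integers, a stretch that wraps around a cycle
  needs no special treatment.\<close>

definition segment :: "(int \<Rightarrow> 'a) \<Rightarrow> int \<Rightarrow> nat \<Rightarrow> 'a list" where
  "segment f s k = map (\<lambda>j. f (s + int j)) [0..<k]"

lemma length_segment [simp]: "length (segment f s k) = k"
  by (simp add: segment_def)

lemma segment_eq_Nil [simp]: "segment f s k = [] \<longleftrightarrow> k = 0"
  by (simp add: segment_def)

lemma set_segment: "set (segment f s k) = f ` {s..<s + int k}"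
proof -
  have "set (segment f s k) = f ` (\<lambda>j. s + int j) ` {0..<k}"
    by (simp add: segment_def image_image)
  also have "(\<lambda>j. s + int j) ` {0..<k} = {s..<s + int k}"
  proof (intro equalityI subsetI)
    fix y assume "y \<in> {s..<s + int k}"
    then have "y = s + int (nat (y - s))" "nat (y - s) \<in> {0..<k}" by auto
    then show "y \<in> (\<lambda>j. s + int j) ` {0..<k}" by (rule image_eqI)
  qed auto
  finally show ?thesis .
qed

lemma hd_segment [simp]: "k > 0 \<Longrightarrow> hd (segment f s k) = f s"
  by (simp add: segment_def hd_map)

lemma last_segment [simp]: "k > 0 \<Longrightarrow> last (segment f s k) = f (s + int k - 1)"
  by (simp add: segment_def last_map of_nat_diff algebra_simps)

lemma vwalk_arcs_segment_subset:
  assumes "\<And>i. (f i, f (i + 1)) \<in> A"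
  shows "set (vwalk_arcs (segment f s k)) \<subseteq> A"
proof (cases k)
  case (Suc k')
  show ?thesis
    unfolding Suc segment_def vwalk_arcs_map_upt
    using assms[of "s + int j" for j] by (auto simp: algebra_simps)
qed (simp add: segment_def)

text \<open>Strong connectivity enters as \<open>ex_forward\<close> and \<open>ex_backward\<close>:
  by \<open>cross\<close>, a pair where \<open>F\<close> fails is an arc from \<open>v\<close> back
  to \<open>u\<close>, so \<open>F\<close> records all arcs between the two cycles.\<close>

locale joined_cycles = pair_digraph D for D :: "'a pair_pre_digraph" +
  fixes u v :: "int \<Rightarrow> 'a" and n m :: nat
  assumes n: "2 \<le> n" and m: "2 \<le> m"
    and u_eq: "u i = u j \<longleftrightarrow> [i = j] (mod int n)"
    and v_eq: "v i = v j \<longleftrightarrow> [i = j] (mod int m)"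
    and u_neq_v: "u i \<noteq> v j"
    and u_arc: "(u i, u (i + 1)) \<in> parcs D"
    and v_arc: "(v i, v (i + 1)) \<in> parcs D"
    and cross: "(v j, u i) \<in> parcs D \<longleftrightarrow> (u i, v j) \<notin> parcs D"
    and ex_forward: "\<exists>i j. (u i, v j) \<in> parcs D"
    and ex_backward: "\<exists>i j. (u i, v j) \<notin> parcs D"
begin

abbreviation F :: "int \<Rightarrow> int \<Rightarrow> bool" where
  "F i j \<equiv> (u i, v j) \<in> parcs D"

lemma F_period: "F (i + c * int n) (j + e * int m) = F i j"
proof -
  have "u (i + c * int n) = u i" "v (j + e * int m) = v j"
    unfolding u_eq v_eq by (simp_all add: cong_def)
  then show ?thesis by simp
qed

lemma u_inj: "s \<le> i \<Longrightarrow> i < s + int n \<Longrightarrow> s \<le> j \<Longrightarrow> j < s + int n \<Longrightarrow> u i = u j \<Longrightarrow> i = j"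
  using cong_less_imp_eq_int[of "i - s" "int n" "j - s"] by (simp add: u_eq cong_diff)

lemma v_inj: "s \<le> i \<Longrightarrow> i < s + int m \<Longrightarrow> s \<le> j \<Longrightarrow> j < s + int m \<Longrightarrow> v i = v j \<Longrightarrow> i = j"
  using cong_less_imp_eq_int[of "i - s" "int m" "j - s"] by (simp add: v_eq cong_diff)

lemma distinct_u: "k \<le> n \<Longrightarrow> distinct (segment u s k)"
  unfolding segment_def by (auto simp: distinct_map inj_on_def dest!: u_inj[of s, rotated 4])

lemma distinct_v: "k \<le> m \<Longrightarrow> distinct (segment v s k)"
  unfolding segment_def by (auto simp: distinct_map inj_on_def dest!: v_inj[of s, rotated 4])

text \<open>The two bounds put both segments, one after the other, into a window of \<open>n\<close>
  consecutive indices, on which \<open>u\<close> is injective.\<close>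

lemma disjoint_u:
  assumes "s + int k \<le> t" "t + int l \<le> s + int n"
  shows "set (segment u s k) \<inter> set (segment u t l) = {}"
proof -
  have False if "s \<le> i" "i < s + int k" "t \<le> j" "j < t + int l" "u i = u j" for i j
    using u_inj[of s i j] that assms by linarith
  then show ?thesis unfolding set_segment by fastforce
qed

lemma disjoint_v:
  assumes "s + int k \<le> t" "t + int l \<le> s + int m"
  shows "set (segment v s k) \<inter> set (segment v t l) = {}"
proof -
  have False if "s \<le> i" "i < s + int k" "t \<le> j" "j < t + int l" "v i = v j" for i j
    using v_inj[of s i j] that assms by linarith
  then show ?thesis unfolding set_segment by fastforce
qed

lemma disjoint_uv: "set (segment u s k) \<inter> set (segment v t l) = {}"
  unfolding set_segment using u_neq_v by auto

section \<open>Explicit cycles built from segments\<close>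

lemma base_cycle: "has_cycle_of_length (with_proj D) n"
proof -
  let ?ws = "segment u 0 n"
  have "has_cycle_of_length (with_proj D) (length ?ws)"
  proof (rule has_cycle_of_vertex_list)
    have "u (int n) = u 0" unfolding u_eq by (simp add: cong_def)
    then show "(last ?ws, hd ?ws) \<in> parcs D"
      using u_arc[of "int n - 1"] n by simp
  qed (use n distinct_u vwalk_arcs_segment_subset[of u, OF u_arc] in auto)
  then show ?thesis by simp
qed

text \<open>The cycle follows \<open>u\<close> for \<open>a\<close> vertices, crosses over to
  \<open>v r\<close>, follows \<open>v\<close> for \<open>b\<close> vertices and returns to
  \<open>u s\<close>; the return arc exists because \<open>F\<close> fails there.\<close>

lemma one_switch_cycle:
  assumes "1 \<le> a" "a \<le> n" "1 \<le> b" "b \<le> m"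
    and "F (s + int a - 1) r" "\<not> F s (r + int b - 1)"
  shows "has_cycle_of_length (with_proj D) (a + b)"
proof -
  let ?ws = "segment u s a @ segment v r b"
  have "set (vwalk_arcs ?ws) \<subseteq> parcs D"
    using assms vwalk_arcs_segment_subset[of u, OF u_arc] vwalk_arcs_segment_subset[of v, OF v_arc]
    by (subst vwalk_arcs_append) auto
  moreover have "distinct ?ws"
    using assms by (simp add: distinct_u distinct_v disjoint_uv)
  moreover have "(last ?ws, hd ?ws) \<in> parcs D"
    using assms by (simp add: cross)
  ultimately have "has_cycle_of_length (with_proj D) (length ?ws)"
    using assms by (intro has_cycle_of_vertex_list) auto
  then show ?thesis by simp
qed

text \<open>Each cycle is visited twice, alternately. The inequalities keep both visits within a
  single turn, so no vertex repeats.\<close>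

lemma two_switch_cycle:
  assumes "1 \<le> a" "1 \<le> b" "1 \<le> a'" "1 \<le> b'"
    and "s + int a \<le> s'" "s' + int a' \<le> s + int n" "r + int b \<le> r'" "r' + int b' \<le> r + int m"
    and "F (s + int a - 1) r" "\<not> F s' (r + int b - 1)"
    and "F (s' + int a' - 1) r'" "\<not> F s (r' + int b' - 1)"
  shows "has_cycle_of_length (with_proj D) (a + b + a' + b')"
proof -
  let ?ws = "segment u s a @ segment v r b @ segment u s' a' @ segment v r' b'"
  have le: "a \<le> n" "a' \<le> n" "b \<le> m" "b' \<le> m" using assms by linarith+
  have "set (vwalk_arcs ?ws) \<subseteq> parcs D"
    using assms vwalk_arcs_segment_subset[of u, OF u_arc] vwalk_arcs_segment_subset[of v, OF v_arc]
    by (simp add: vwalk_arcs_append cross)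
  moreover have "distinct ?ws"
    using le assms disjoint_uv disjoint_u[of s a s' a'] disjoint_v[of r b r' b']
    by (auto simp: distinct_u distinct_v Int_Un_distrib Int_commute[of "set (segment v _ _)" "set (segment u _ _)"])
  moreover have "(last ?ws, hd ?ws) \<in> parcs D"
    using assms by (simp add: cross)
  ultimately have "has_cycle_of_length (with_proj D) (length ?ws)"
    using assms by (intro has_cycle_of_vertex_list) auto
  then show ?thesis by (simp add: add.assoc)
qed

section \<open>Symmetries of \<open>F\<close> forced by a missing length\<close>

text \<open>A shift acts on the torus of index pairs with finite order, so preserving \<^term>\<open>F\<close> in one
  direction is enough for invariance.\<close>
lemma F_shift_invariant:
  assumes step: "\<And>i j. F i j \<Longrightarrow> F (i + c) (j + e)"
  shows "F (i + c) (j + e) = F i j"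
proof
  have iter: "F i j \<Longrightarrow> F (i + int k * c) (j + int k * e)" for k i j
    by (induction k) (use step[of "i + int k * c" "j + int k * e" for k] in \<open>auto simp: algebra_simps\<close>)
  \<comment> \<open>One shift has been made already; \<open>k = n * m - 1\<close> more make
    \<open>n * m\<close> shifts, which act trivially modulo \<open>n\<close> and
    \<open>m\<close>.\<close>
  obtain k where k: "n * m = Suc k" using n m by (cases "n * m") auto
  have nm: "int n * int m = int k + 1" using k by (metis of_nat_Suc of_nat_mult add.commute)
  assume "F (i + c) (j + e)"
  then have "F (i + c + int k * c) (j + e + int k * e)" by (rule iter)
  moreover have "i + c + int k * c = i + (c * int m) * int n" "j + e + int k * e = j + (e * int n) * int m"
    using nm by algebra+
  ultimately show "F i j" using F_period by metis
qed (rule step)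

text \<open>If \<open>F i j\<close> holds, let the segment of \<open>u\<close> end at
  \<open>i\<close> and that of \<open>v\<close> start at \<open>j\<close>. The return arc must be
  missing, which says that \<open>F\<close> holds at the shifted pair.\<close>

lemma no_cycle_imp_F_shift:
  assumes "\<not> has_cycle_of_length (with_proj D) (a + b)" "1 \<le> a" "a \<le> n" "1 \<le> b" "b \<le> m"
  shows "F (i - int a + 1) (j + int b - 1) = F i j"
proof -
  have "F (i' + (1 - int a)) (j' + (int b - 1))" if "F i' j'" for i' j'
    using one_switch_cycle[of a b "i' + (1 - int a)" j'] that assms by (auto simp: algebra_simps)
  then have "F (i + (1 - int a)) (j + (int b - 1)) = F i j" by (rule F_shift_invariant)
  then show ?thesis by (simp add: algebra_simps)
qed

lemma F_nonconstant:
  assumes "\<And>i j. F i j = g (i + c * j)"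
  obtains p q where "\<not> g p" "g q"
  using assms ex_forward ex_backward by metis

section \<open>Cycles of the required lengths\<close>

lemma spanning_cycle: "has_cycle_of_length (with_proj D) (n + m)"
proof (rule ccontr)
  assume no: "\<not> ?thesis"
  \<comment> \<open>For \<open>a = n\<close> and \<open>b = m\<close> the shift
    \<open>(1 - n, m - 1)\<close> equals \<open>(1, -1)\<close> modulo the periods.\<close>
  have inv: "F (i + 1) (j - 1) = F i j" for i j
    using no_cycle_imp_F_shift[OF no, of i j] F_period[of "i + 1" "-1" "j - 1" 1] n m
    by (simp add: algebra_simps)
  define g where "g x = F x 0" for x
  have "F (i + c) (j - c) = F i j" for i j c
    using periodic_int_multiple[of "\<lambda>x. F (i + x) (j - x)" 1 0 c]
      inv[of "i + x" "j - x" for x] by (simp add: algebra_simps)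
  from this[of _ j j for j] have Fg: "F i j = g (i + j)" for i j
    by (simp add: g_def)
  have gn: "g (x + int n) = g x" for x
    using F_period[of x 1 0 0] by (simp add: g_def)
  have gm: "g (x + int m) = g x" for x
    using F_period[of x 0 0 1] Fg by simp
  have n0: "n > 0" using n by simp
  obtain y z where yz: "\<not> g y" "g z" using F_nonconstant[of g 1] Fg by auto
  obtain p where p: "\<not> g p" "g (p + 1)" by (rule periodic_imp_ascent[of g n, OF gn n0 yz])
  obtain q where q: "g q" "\<not> g (q + 1)" by (rule periodic_imp_descent[of g n, OF gn n0 yz])
  \<comment> \<open>Modulo the period \<open>m\<close> of \<open>g\<close>, the index
    \<open>p + b\<close> is \<open>q\<close>. So the ascent at \<open>p\<close> and the descent at
    \<open>q\<close> sit \<open>b\<close> steps apart within one turn of \<open>v\<close>.\<close>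
  define b where "b = nat ((q - p) mod int m)"
  have b: "int b = (q - p) mod int m" "int b < int m"
    using m by (simp_all add: b_def)
  have pb: "g (p + int b + c) = g (q + c)" for c
  proof -
    have "p + int b + c = q + c + (- ((q - p) div int m)) * int m"
      using b(1) div_mult_mod_eq[of "q - p" "int m"] by (simp add: algebra_simps)
    then show ?thesis using periodic_int_multiple[of g, OF gm] by metis
  qed
  have "b \<noteq> 0"
  proof
    assume "b = 0"
    then show False using pb[of 0] p q by simp
  qed
  \<comment> \<open>The tour is \<open>u 0\<close>, then \<open>v\<close> from \<open>p + 1\<close>
    to \<open>p + b\<close>, then the rest of \<open>u\<close>, then the rest of \<open>v\<close>.
    Its four crossings use \<open>g\<close> at \<open>p + 1\<close>, \<open>q + 1\<close>,
    \<open>q\<close> and \<open>p\<close>, up to periods.\<close>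
  have "has_cycle_of_length (with_proj D) (1 + b + (n - 1) + (m - b))"
  proof (rule two_switch_cycle[where s = 0 and s' = 1 and r = "p + 1" and r' = "p + 1 + int b"])
    show "F (0 + int 1 - 1) (p + 1)" using p Fg by simp
    show "\<not> F 1 (p + 1 + int b - 1)" using q pb[of 1] Fg by (simp add: algebra_simps)
    show "F (1 + int (n - 1) - 1) (p + 1 + int b)"
      using q pb[of 0] gn[of "p + int b"] Fg n by (simp add: of_nat_diff algebra_simps)
    show "\<not> F 0 (p + 1 + int b + int (m - b) - 1)"
      using p gm[of p] Fg b by (simp add: of_nat_diff algebra_simps)
  qed (use n m b \<open>b \<noteq> 0\<close> in auto)
  moreover have "1 + b + (n - 1) + (m - b) = n + m" using n b by simp
  ultimately show False using no by metis
qed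

text \<open>The hypothesis on the length leaves two adjacent ways of splitting it between the cycles;
  the quotient of the corresponding two shifts is the diagonal shift.\<close>
lemma no_cycle_imp_difference_form:
  assumes no: "\<not> has_cycle_of_length (with_proj D) l" and l: "3 \<le> l" "l < n + m"
  obtains h where "\<And>i j. F i j = h (i - j)" "\<And>x. h (x + int n) = h x" "\<And>x. h (x + int m) = h x"
    "\<And>x. h (x + (int l - 2)) = h x"
proof -
  obtain a b where ab: "l = Suc a + b" "1 \<le> a" "Suc a \<le> n" "1 \<le> b" "Suc b \<le> m"
  proof (cases "l \<le> n")
    case True
    then show ?thesis using that[of "l - 2" 1] l m by simp
  next
    case False
    then show ?thesis using that[of "n - 1" "l - n"] l n by simp
  qed
  have s1: "F (i - int a) (j + int b - 1) = F i j" for i j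
    using no_cycle_imp_F_shift[of "Suc a" b i j] no ab by simp
  have s2: "F (i - int a + 1) (j + int b) = F i j" for i j
    using no_cycle_imp_F_shift[of a "Suc b" i j] no ab by simp
  have inv: "F (i + 1) (j + 1) = F i j" for i j
    using s1[of "i + int a" "j - int b + 1"] s2[of "i + int a" "j - int b + 1"]
    by (simp add: algebra_simps)
  define h where "h x = F x 0" for x
  have "F (i + c) (j + c) = F i j" for i j c
    using periodic_int_multiple[of "\<lambda>x. F (i + x) (j + x)" 1 0 c]
      inv[of "i + x" "j + x" for x] by (simp add: algebra_simps)
  from this[of _ "-j" j for j] have Fh: "F i j = h (i - j)" for i j
    by (simp add: h_def)
  show thesis
  proof (rule that[of h])
    show "F i j = h (i - j)" for i j by (rule Fh)
    show "h (x + int n) = h x" for x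
      using F_period[of x 1 0 0] by (simp add: h_def)
    show "h (x + int m) = h x" for x
      using F_period[of x 0 0 "-1"] Fh by simp
    \<comment> \<open>The shift \<open>(- a, b - 1)\<close> lowers the difference of the indices by
      \<open>a + b - 1 = l - 2\<close>.\<close>
    show "h (x + (int l - 2)) = h x" for x
      using s1[of "x + int a + int b - 1" 0] Fh ab(1) by (simp add: algebra_simps)
  qed
qed

lemma short_cycle:
  assumes l: "3 \<le> l" "l \<le> n + 1"
  shows "has_cycle_of_length (with_proj D) l"
proof (rule ccontr)
  assume no: "\<not> ?thesis"
  obtain h where Fh: "\<And>i j. F i j = h (i - j)" and hn: "\<And>x. h (x + int n) = h x"
    and hm: "\<And>x. h (x + int m) = h x" and hl: "\<And>x. h (x + (int l - 2)) = h x"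
    by (rule no_cycle_imp_difference_form[OF no]) (use l m in auto)
  have n0: "n > 0" using n by simp
  obtain y z where yz: "\<not> h y" "h z" using F_nonconstant[of h "-1"] Fh by auto
  obtain x where x: "h x" "\<not> h (x + 1)" by (rule periodic_imp_descent[of h n, OF hn n0 yz])
  \<comment> \<open>For \<open>l = 3\<close> the period \<open>l - 2\<close> is 1, against the
    descent at \<open>x\<close>.\<close>
  have "l \<noteq> 3" using hl[of x] x by auto
  then have l4: "4 \<le> l" using l by simp
  have "has_cycle_of_length (with_proj D) (1 + 1 + (l - 3) + 1)"
  \<comment> \<open>Leaving \<open>u 0\<close> for \<open>v (- x)\<close> and returning to
    \<open>u 1\<close> uses the descent at \<open>x\<close>. The last vertex is the predecessor of
    \<open>v (- x)\<close>, with \<open>m\<close> added to its index to place it later in the turn;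
    its crossings use the descent again, through the periods \<open>l - 2\<close> and
    \<open>m\<close>.\<close>
  proof (rule two_switch_cycle[where s = 0 and s' = 1 and r = "- x" and r' = "int m - x - 1"])
    show "F (1 + int (l - 3) - 1) (int m - x - 1)"
      using x hl[of x] hm[of "int l - 2 + x - int m"] Fh l4
      by (simp add: of_nat_diff algebra_simps)
    show "\<not> F 0 (int m - x - 1 + int 1 - 1)"
      using x hm[of "x + 1 - int m"] Fh by (simp add: algebra_simps)
  qed (use l l4 n m x Fh in \<open>auto simp: algebra_simps\<close>)
  moreover have "1 + 1 + (l - 3) + 1 = l" using l by simp
  ultimately show False using no by metis
qed

text \<open>Divisibility makes \<open>l\<close> a period of \<open>h\<close> besides
  \<open>l - 2\<close>, hence also 2. This allows a tour through all of \<open>u\<close> that meets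
  \<open>v\<close> in two adjacent segments.\<close>

lemma long_cycle:
  assumes l: "n + 2 \<le> l" "l < n + m" and dvd: "gcd n m dvd l"
  shows "has_cycle_of_length (with_proj D) l"
proof (rule ccontr)
  assume no: "\<not> ?thesis"
  obtain h where Fh: "\<And>i j. F i j = h (i - j)" and hn: "\<And>x. h (x + int n) = h x"
    and hm: "\<And>x. h (x + int m) = h x" and hl2: "\<And>x. h (x + (int l - 2)) = h x"
    by (rule no_cycle_imp_difference_form[OF no]) (use l n m in auto)
  have "gcd (int n) (int m) dvd int l" using dvd by simp
  then have hl: "h (x + int l) = h x" for x
    by (rule periodic_gcd_multiple[of h, OF hn hm])
  have n0: "n > 0" using n by simp
  obtain y z where yz: "\<not> h y" "h z" using F_nonconstant[of h "-1"] Fh by auto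
  obtain x where x: "h x" "\<not> h (x + 1)" by (rule periodic_imp_descent[of h n, OF hn n0 yz])
  have "h (x - 2) = h x"
    using hl2[of x] hl[of "x - 2"] by (simp add: algebra_simps)
  then have 1: "h (x + int n - 2)"
    using x hn[of "x - 2"] by (simp add: algebra_simps)
  have 2: "\<not> h (x + 1 + int n - int l)"
    using x hn[of "x + 1"] hl[of "x + 1 + int n - int l"] by (simp add: algebra_simps)
  have "has_cycle_of_length (with_proj D) (1 + 1 + (n - 1) + (l - n - 1))"
  \<comment> \<open>The first two crossings are the descent at \<open>x\<close>. The third compares
    \<open>u (n - 1)\<close> with \<open>v (1 - x)\<close>, a difference of
    \<open>x + n - 2\<close>; the fourth has difference \<open>x + 1 + n - l\<close>.\<close>
  proof (rule two_switch_cycle[where s = 0 and s' = 1 and r = "- x" and r' = "1 - x"])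
    show "F (1 + int (n - 1) - 1) (1 - x)"
      using 1 Fh n by (simp add: of_nat_diff algebra_simps)
    show "\<not> F 0 (1 - x + int (l - n - 1) - 1)"
      using 2 Fh l by (simp add: of_nat_diff algebra_simps)
  qed (use l n m x Fh in \<open>auto simp: algebra_simps\<close>)
  moreover have "1 + 1 + (n - 1) + (l - n - 1) = l" using l n by simp
  ultimately show False using no by metis
qed

end

section \<open>Generalized sums\<close>

text \<open>If no arc left \<open>A\<close>, everything reachable from \<open>x\<close> would stay
  in \<open>A\<close>, including \<open>y\<close>.\<close>

lemma strongly_connected_imp_exit_arc:
  assumes "strongly_connected (with_proj G)" "A \<subseteq> pverts G" "x \<in> A" "y \<in> pverts G" "y \<notin> A"
    and "pair_digraph G"
  obtains a b where "a \<in> A" "b \<in> pverts G" "b \<notin> A" "(a, b) \<in> parcs G"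
proof (rule ccontr)
  assume no: "\<not> thesis"
  interpret pair_digraph G by fact
  have "x \<rightarrow>\<^sup>*\<^bsub>with_proj G\<^esub> y"
    using assms(1-4) by (auto simp: strongly_connected_def)
  then have "y \<in> A"
  proof (induction rule: reachable_induct)
    case base
    then show ?case using assms(3) by simp
  next
    case (step b c)
    then show ?case using no that in_arcsD2 by (auto simp: in_arcsD2)
  qed
  then show False using assms(5) by simp
qed

theorem theorem34:
  fixes D1 D2 D :: "'a pair_pre_digraph" and n m d :: nat
  assumes "pair_digraph D1" and "pair_digraph D2"
    and "pverts D1 \<inter> pverts D2 = {}"
    and "hamiltonian (with_proj D1)" and "hamiltonian (with_proj D2)"
    and "card (pverts D1) = n" and "card (pverts D2) = m"
    and "n \<ge> m"
    and "d = gcd n m"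
    and "D \<in> D1 \<oplus>\<^sub>g D2"
    and "strongly_connected (with_proj D)"
  shows "vertex_pancyclic (with_proj D) \<or>
         pancyclic (with_proj D) \<or>
         (hamiltonian (with_proj D) \<and>
          (\<forall>l \<in> {3..n + 1} \<union> {n + i * d | i :: nat. i < m div d}.
             has_cycle_of_length (with_proj D) l))"
proof -
  have D: "pair_digraph D" and verts: "pverts D = pverts D1 \<union> pverts D2"
    and ind1: "with_proj D \<restriction> pverts D1 = with_proj D1"
    and ind2: "with_proj D \<restriction> pverts D2 = with_proj D2"
    and cross: "\<And>x y. x \<in> pverts D1 \<Longrightarrow> y \<in> pverts D2 \<Longrightarrow> ((x, y) \<in> parcs D) \<noteq> ((y, x) \<in> parcs D)"
    using \<open>D \<in> D1 \<oplus>\<^sub>g D2\<close> unfolding generalized_sum_def by auto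
  have sub1: "parcs D1 \<subseteq> parcs D"
    using arg_cong[OF ind1, of arcs] by (auto simp: induce_subgraph_def)
  have sub2: "parcs D2 \<subseteq> parcs D"
    using arg_cong[OF ind2, of arcs] by (auto simp: induce_subgraph_def)
  obtain u where u: "2 \<le> n" "\<forall>i j. u i = u j \<longleftrightarrow> [i = j] (mod int n)"
    "\<forall>i. (u i, u (i + 1)) \<in> parcs D1" "range u = pverts D1"
    by (rule pair_digraph.hamiltonian_periodic_enumeration[OF assms(1,4,6)])
  obtain v where v: "2 \<le> m" "\<forall>i j. v i = v j \<longleftrightarrow> [i = j] (mod int m)"
    "\<forall>i. (v i, v (i + 1)) \<in> parcs D2" "range v = pverts D2"
    by (rule pair_digraph.hamiltonian_periodic_enumeration[OF assms(2,5,7)])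
  have u0: "u i \<in> pverts D1" and v0: "v i \<in> pverts D2" for i
    using u(4) v(4) by blast+
  have dis: "v j \<notin> pverts D1" "u i \<notin> pverts D2" for i j using u0 v0 assms(3) by blast+
  have cr: "((v j, u i) \<in> parcs D) = ((u i, v j) \<notin> parcs D)" for i j
    using cross[OF u0 v0] by blast
  have sub: "pverts D1 \<subseteq> pverts D" "pverts D2 \<subseteq> pverts D" using verts by auto
  \<comment> \<open>An arc leaving the vertices of one summand must enter the other; this and the
    next step yield crossing arcs in both directions.\<close>
  obtain a b where ab: "a \<in> pverts D1" "b \<in> pverts D2" "(a, b) \<in> parcs D"
    using strongly_connected_imp_exit_arc[OF assms(11) sub(1) u0 _ dis(1) D] v0 sub verts
    by (metis Un_iff subsetD)
  obtain a' b' where ab': "a' \<in> pverts D1" "b' \<in> pverts D2" "(b', a') \<in> parcs D"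
    using strongly_connected_imp_exit_arc[OF assms(11) sub(2) v0 _ dis(2) D] u0 sub verts
    by (metis Un_iff subsetD)
  interpret pair_digraph D by (fact D)
  interpret joined_cycles D u v n m
  proof unfold_locales
    show "u i \<noteq> v j" for i j using u0 dis by metis
    show "\<exists>i j. (u i, v j) \<in> parcs D"
      using ab u(4) v(4) by (metis imageE)
    show "\<exists>i j. (u i, v j) \<notin> parcs D"
      using ab' u(4) v(4) cr by (metis imageE)
  qed (use u v cr sub1 sub2 in auto)
  have card: "card (pverts D) = n + m"
    using verts assms(3,6,7) pair_finite_verts by (simp add: card_Un_disjoint)
  have "has_cycle_of_length (with_proj D) (n + i * d)" if "i < m div d" for i
  proof -
    \<comment> \<open>Length \<open>n\<close> is the cycle \<open>u\<close> itself and
      \<open>n + 1\<close> counts as short. Otherwise \<open>d\<close> divides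
      \<open>n + i * d\<close>, which is below \<open>n + m\<close> by the bound on
      \<open>i\<close>.\<close>
    consider "i * d = 0" | "i * d = 1" | "n + 2 \<le> n + i * d" by linarith
    then show ?thesis
    proof cases
      case 1
      then show ?thesis using base_cycle by (metis add_0_right)
    next
      case 2
      have "has_cycle_of_length (with_proj D) (n + 1)" using n by (intro short_cycle) auto
      then show ?thesis using 2 by metis
    next
      case 3
      have "d > 0" using \<open>d = gcd n m\<close> n by simp
      then have "i * d < m div d * d" using that by simp
      also have "\<dots> = m" using \<open>d = gcd n m\<close> by simp
      finally show ?thesis using 3 \<open>d = gcd n m\<close> by (intro long_cycle) auto
    qed
  qed
  then have "\<forall>l \<in> {3..n + 1} \<union> {n + i * d | i :: nat. i < m div d}.
      has_cycle_of_length (with_proj D) l"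
    using short_cycle by auto
  moreover have "hamiltonian (with_proj D)"
    using spanning_cycle_imp_hamiltonian spanning_cycle card by simp
  ultimately show ?thesis by blast
qed

end
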